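(* Let $0<a<\frac12$ and $u\in\mathbb{R}$ be fixed, let $n\in\mathbb{N}$, and put $q=\exp(-2\pi n^{-a})$. Then, as $n\to\infty$, $$E_q\!\left(\exp 2\pi\left(u+n^{1-a}-\tfrac12 n^{-a}\right)\right)=\exp\left\{\pi n^{-a}(n^a u+n)^2+\frac{\pi}{12}\left(n^a-n^{-a}\right)\right\}\left\{1+\mathcal{O}\left(e^{-\pi n^a}\right)\right\},$$ and $$E_q\!\left(-\exp 2\pi\left(u+n^{1-a}-\tfrac12 n^{-a}\right)\right)=\frac{2\exp\left(\pi n^{-a}(n^a u+n)^2\right)\cos(\pi n^a u)}{(-1)^n\exp\left\{\frac{\pi}{12}\left(2n^a+n^{-a}\right)\right\}}\left\{1+\mathcal{O}\left(e^{-2\pi n^a}\right)\right\}.$$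
   Context: For $0<q<1$ and $z\in\mathbb{C}$, Euler's $q$-exponential is $E_q(z)=(-z;q)_\infty=\sum_{k=0}^\infty \frac{q^{k(k-1)/2}}{(q;q)_k}z^k$, where $(c;q)_\infty=\prod_{k=0}^\infty(1-cq^k)$ and $(c;q)_k=\prod_{j=0}^{k-1}(1-cq^j)$. Note that $q$ depends on $n$. The $\mathcal{O}$ terms are as $n\to\infty$ with $a,u$ fixed (implied constants may depend on $a,u$). *)

theory Defs
  imports "HOL-Analysis.Analysis" "HOL-Library.Landau_Symbols"
begin

definition qpochhammer_inf :: "complex \<Rightarrow> real \<Rightarrow> complex" where
  "qpochhammer_inf c q = (\<Prod>k. 1 - c * of_real q ^ k)"

text \<open>The infinite product converges for \<open>\<bar>q\<bar> < 1\<close>; a vanishing factor (\<open>c = q\<^sup>-\<^sup>k\<close>) is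
  allowed and makes the product zero.\<close>

lemma convergent_prod_qpochhammer:
  fixes c :: complex and q :: real
  assumes "\<bar>q\<bar> < 1"
  shows "convergent_prod (\<lambda>k. 1 - c * of_real q ^ k)"
proof -
  have "summable (\<lambda>k. norm c * \<bar>q\<bar> ^ k)"
    using assms by (intro summable_mult summable_geometric) auto
  then have "summable (\<lambda>k. norm ((1 - c * of_real q ^ k) - 1))"
    by (simp add: norm_mult norm_power)
  then show ?thesis
    by (intro abs_convergent_prod_imp_convergent_prod) (simp add: abs_convergent_prod_conv_summable)
qed

definition q_exponential :: "real \<Rightarrow> complex \<Rightarrow> complex" where
  "q_exponential q z = qpochhammer_inf (- z) q"

end

theory Submission
  imports Defs "HOL-Complex_Analysis.Complex_Analysis" "HOL-Real_Asymp.Real_Asymp"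
begin

text \<open>
  Put \<open>h = n powr (- a)\<close>, \<open>q = exp (- 2 * pi * h)\<close> and \<open>s = n powr a * u + n\<close>. The function
  \<open>\<Theta> h s = E\<^sub>q(q powr (1/2 - s)) * E\<^sub>q(q powr (1/2 + s))\<close> satisfies the modular relation
  \<open>\<Theta> h s = exp (pi * h * s\<^sup>2 + pi / 12 * (1 / h - h)) * \<Theta> (1 / h) (\<i> * h * s)\<close>.
  By Liouville's theorem the two sides agree up to a constant. At the points
  \<open>0\<close>, \<open>1 / 2\<close>, \<open>\<i> / (2 * h)\<close> Euler's identity
  \<open>E\<^sub>q(q powr (1/2)) * E\<^sub>q(- q powr (1/2)) * E\<^sub>q(q) = 1\<close> makes the product of the three values
  explicit on both sides, which gives the cube of the constant.
  The two expansions are the modular relation at \<open>s\<close> and at \<open>s + \<i> / (2 * h)\<close>: the factor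
  \<open>E\<^sub>q(\<plusminus> q powr (1/2 + s))\<close> and the infinite products in the nome \<open>exp (- 2 * pi / h)\<close> are
  exponentially close to \<open>1\<close>.
\<close>

subsection \<open>The q-exponential function\<close>

lemma has_prod_q_exponential:
  assumes "\<bar>q\<bar> < 1"
  shows "(\<lambda>k. 1 + z * of_real q ^ k) has_prod q_exponential q z"
  using convergent_prod_has_prod[OF convergent_prod_qpochhammer[OF assms, of "- z"]]
  by (simp add: q_exponential_def qpochhammer_inf_def)

lemma q_exponential_LIMSEQ:
  assumes "\<bar>q\<bar> < 1"
  shows "(\<lambda>n. \<Prod>k<n. 1 + z * of_real q ^ k) \<longlonglongrightarrow> q_exponential q z"
  using has_prod_imp_tendsto'[OF has_prod_q_exponential[OF assms]] .

lemma q_exponential_rec: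
  assumes "\<bar>q\<bar> < 1"
  shows "q_exponential q z = (1 + z) * q_exponential q (of_real q * z)"
proof (rule LIMSEQ_unique)
  show "(\<lambda>n. \<Prod>k<Suc n. 1 + z * of_real q ^ k) \<longlonglongrightarrow> q_exponential q z"
    using q_exponential_LIMSEQ[OF assms] by (rule LIMSEQ_Suc)
  have "(\<lambda>n. (1 + z) * (\<Prod>k<n. 1 + of_real q * z * of_real q ^ k))
          \<longlonglongrightarrow> (1 + z) * q_exponential q (of_real q * z)"
    by (intro tendsto_intros q_exponential_LIMSEQ assms)
  then show "(\<lambda>n. \<Prod>k<Suc n. 1 + z * of_real q ^ k)
          \<longlonglongrightarrow> (1 + z) * q_exponential q (of_real q * z)"
    by (simp only: prod.lessThan_Suc_shift) (simp add: mult_ac)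
qed

lemma q_exponential_eq_0_iff:
  assumes "\<bar>q\<bar> < 1"
  shows "q_exponential q z = 0 \<longleftrightarrow> (\<exists>k. z * of_real q ^ k = - 1)"
proof -
  have "q_exponential q z = 0 \<longleftrightarrow> (\<exists>k. 1 + z * of_real q ^ k = 0)"
    using has_prod_eq_0_iff[OF has_prod_q_exponential[OF assms]] by (auto simp: image_iff)
  then show ?thesis
    by (simp add: eq_neg_iff_add_eq_0 add.commute)
qed

lemma q_exponential_nonzero:
  assumes "\<bar>q\<bar> < 1" "norm z < 1"
  shows "q_exponential q z \<noteq> 0"
proof
  assume "q_exponential q z = 0"
  then obtain k where "z * of_real q ^ k = - 1"
    using assms q_exponential_eq_0_iff by blast
  then have "norm z * \<bar>q\<bar> ^ k = 1"
    by (metis norm_minus_cancel norm_mult norm_of_real norm_one norm_power)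
  moreover have "norm z * \<bar>q\<bar> ^ k \<le> norm z * 1"
    using assms by (intro mult_left_mono power_le_one) auto
  ultimately show False
    using assms by simp
qed

lemma cnj_q_exponential:
  assumes "\<bar>q\<bar> < 1"
  shows "cnj (q_exponential q z) = q_exponential q (cnj z)"
proof (rule LIMSEQ_unique)
  show "(\<lambda>n. cnj (\<Prod>k<n. 1 + z * of_real q ^ k)) \<longlonglongrightarrow> cnj (q_exponential q z)"
    by (intro tendsto_cnj q_exponential_LIMSEQ assms)
  show "(\<lambda>n. cnj (\<Prod>k<n. 1 + z * of_real q ^ k)) \<longlonglongrightarrow> q_exponential q (cnj z)"
    using q_exponential_LIMSEQ[OF assms, of "cnj z"] by simp
qed

text \<open>A product of factors \<open>1 + a_k\<close> differs from 1 by at most the product of the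
  \<open>1 + norm a_k\<close> minus 1, and \<open>1 + t \<le> exp t\<close> turns that into the
  exponential of a geometric sum. All error terms below come from this bound.\<close>

lemma norm_q_exponential_minus_1_le:
  assumes "0 \<le> q" "q < 1"
  shows "norm (q_exponential q z - 1) \<le> exp (norm z / (1 - q)) - 1"
proof (rule tendsto_upperbound)
  show "(\<lambda>n. norm ((\<Prod>k<n. 1 + z * of_real q ^ k) - 1)) \<longlonglongrightarrow> norm (q_exponential q z - 1)"
    using assms by (intro tendsto_intros q_exponential_LIMSEQ) auto
  show "\<forall>\<^sub>F n in sequentially. norm ((\<Prod>k<n. 1 + z * of_real q ^ k) - 1) \<le> exp (norm z / (1 - q)) - 1"
  proof (rule always_eventually, intro allI)
    fix n
    have "norm ((\<Prod>k<n. 1 + z * of_real q ^ k) - 1) \<le> (\<Prod>k<n. 1 + norm (z * of_real q ^ k)) - 1"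
      by (rule norm_prod_minus1_le_prod_minus1)
    also have "(\<Prod>k<n. 1 + norm (z * of_real q ^ k)) \<le> exp (\<Sum>k<n. norm (z * of_real q ^ k))"
      by (rule prod_le_exp_sum) auto
    also have "(\<Sum>k<n. norm (z * of_real q ^ k)) = norm z * (\<Sum>k<n. q ^ k)"
      using assms by (simp add: norm_mult norm_power sum_distrib_left)
    also have "(\<Sum>k<n. q ^ k) \<le> (\<Sum>k. q ^ k)"
      using assms by (intro sum_le_suminf summable_geometric) auto
    also have "(\<Sum>k. q ^ k) = 1 / (1 - q)"
      using assms by (intro suminf_geometric) auto
    finally show "norm ((\<Prod>k<n. 1 + z * of_real q ^ k) - 1) \<le> exp (norm z / (1 - q)) - 1"
      by (simp add: mult_left_mono)
  qed
qed simp

section \<open>Parity splitting and Euler's identity\<close>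

lemma q_exponential_mult_minus:
  assumes "\<bar>q\<bar> < 1"
  shows "q_exponential q z * q_exponential q (- z) = q_exponential (q\<^sup>2) (- (z\<^sup>2))"
proof (rule LIMSEQ_unique)
  have q2: "\<bar>q\<^sup>2\<bar> < 1"
    using assms by (simp add: abs_square_less_1)
  show "(\<lambda>n. (\<Prod>k<n. 1 + z * of_real q ^ k) * (\<Prod>k<n. 1 + - z * of_real q ^ k))
          \<longlonglongrightarrow> q_exponential q z * q_exponential q (- z)"
    by (intro tendsto_intros q_exponential_LIMSEQ assms)
  show "(\<lambda>n. (\<Prod>k<n. 1 + z * of_real q ^ k) * (\<Prod>k<n. 1 + - z * of_real q ^ k))
          \<longlonglongrightarrow> q_exponential (q\<^sup>2) (- (z\<^sup>2))"
    using q_exponential_LIMSEQ[OF q2, of "- (z\<^sup>2)"]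
    by (simp add: prod.distrib[symmetric] algebra_simps power2_eq_square power_mult_distrib)
qed

lemma q_exponential_even_odd:
  assumes "\<bar>q\<bar> < 1"
  shows "q_exponential q z = q_exponential (q\<^sup>2) z * q_exponential (q\<^sup>2) (of_real q * z)"
proof (rule LIMSEQ_unique)
  have q2: "\<bar>q\<^sup>2\<bar> < 1"
    using assms by (simp add: abs_square_less_1)
  \<comment> \<open>Even and odd exponents separate exactly in partial products of even length,
    hence the subsequence \<open>2 * n\<close>.\<close>
  have eq: "(\<Prod>k<2 * n. 1 + z * of_real q ^ k)
      = (\<Prod>k<n. 1 + z * of_real (q\<^sup>2) ^ k) * (\<Prod>k<n. 1 + of_real q * z * of_real (q\<^sup>2) ^ k)" for n
    by (induction n) (simp_all add: power_mult power2_eq_square power_mult_distrib mult_ac)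
  have "strict_mono (\<lambda>n::nat. 2 * n)"
    by (simp add: strict_mono_def)
  from LIMSEQ_subseq_LIMSEQ[OF q_exponential_LIMSEQ[OF assms, of z] this]
  show "(\<lambda>n. (\<Prod>k<n. 1 + z * of_real (q\<^sup>2) ^ k) * (\<Prod>k<n. 1 + of_real q * z * of_real (q\<^sup>2) ^ k))
          \<longlonglongrightarrow> q_exponential q z"
    by (simp add: o_def eq)
  show "(\<lambda>n. (\<Prod>k<n. 1 + z * of_real (q\<^sup>2) ^ k) * (\<Prod>k<n. 1 + of_real q * z * of_real (q\<^sup>2) ^ k))
          \<longlonglongrightarrow> q_exponential (q\<^sup>2) z * q_exponential (q\<^sup>2) (of_real q * z)"
    by (intro tendsto_intros q_exponential_LIMSEQ q2)
qed

text \<open>Splitting the products of base \<open>r\<close> at \<open>r\<close> and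
  \<open>- r\<close> by parity yields the three factors and one extra factor, the value of base
  \<open>r\<^sup>2\<close> at \<open>- (r\<^sup>2)\<close>. Pairing \<open>1 + z * r ^ k\<close>
  with \<open>1 - z * r ^ k\<close> shows that the same two products multiply to this extra factor,
  so it cancels.\<close>

lemma euler_q_exponential_triple:
  assumes "\<bar>r\<bar> < 1"
  shows "q_exponential (r\<^sup>2) (of_real r) * q_exponential (r\<^sup>2) (- of_real r)
           * q_exponential (r\<^sup>2) (of_real (r\<^sup>2)) = 1"
proof -
  let ?E = "q_exponential" and ?r = "of_real r :: complex"
  have "?E r ?r = ?E (r\<^sup>2) ?r * ?E (r\<^sup>2) (of_real (r\<^sup>2))"
    using q_exponential_even_odd[OF assms, of ?r] by (simp add: power2_eq_square)
  moreover have "?E r (- ?r) = ?E (r\<^sup>2) (- ?r) * ?E (r\<^sup>2) (- (?r\<^sup>2))"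
    using q_exponential_even_odd[OF assms, of "- ?r"] by (simp add: power2_eq_square)
  moreover have "?E r ?r * ?E r (- ?r) = ?E (r\<^sup>2) (- (?r\<^sup>2))"
    by (rule q_exponential_mult_minus[OF assms])
  ultimately have "?E (r\<^sup>2) ?r * ?E (r\<^sup>2) (- ?r) * ?E (r\<^sup>2) (of_real (r\<^sup>2)) * ?E (r\<^sup>2) (- (?r\<^sup>2))
      = ?E (r\<^sup>2) (- (?r\<^sup>2))"
    by (simp add: mult_ac)
  moreover have "?E (r\<^sup>2) (- (?r\<^sup>2)) \<noteq> 0"
    using assms by (intro q_exponential_nonzero) (auto simp: norm_power abs_square_less_1 power2_less_1_iff)
  ultimately show ?thesis
    by simp
qed

lemma holomorphic_q_exponential:
  assumes "\<bar>q\<bar> < 1"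
  shows "q_exponential q holomorphic_on A"
proof (rule holomorphic_on_subset)
  let ?P = "\<lambda>n z. \<Prod>k<n. 1 + z * of_real q ^ k :: complex"
  \<comment> \<open>Unit discs around every point give locally uniform convergence; on such a disc
    \<open>(norm w + 1) * \<bar>q\<bar> ^ k\<close> is a summable majorant.\<close>
  have "uniform_limit (cball w 1) ?P (q_exponential q) sequentially" for w
  proof -
    have "uniformly_convergent_on (cball w 1) ?P"
    proof (rule uniformly_convergent_on_prod')
      show "uniformly_convergent_on (cball w 1) (\<lambda>N z. \<Sum>k<N. norm (1 + z * of_real q ^ k - 1))"
      proof (rule Weierstrass_m_test')
        show "norm (norm (1 + z * of_real q ^ k - 1)) \<le> (norm w + 1) * \<bar>q\<bar> ^ k"
          if "z \<in> cball w 1" for k z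
        proof -
          have "norm z \<le> norm w + 1"
            using that norm_triangle_sub[of z w] by (simp add: dist_norm norm_minus_commute)
          then show ?thesis
            by (auto simp: norm_mult norm_power intro!: mult_right_mono)
        qed
        show "summable (\<lambda>k. (norm w + 1) * \<bar>q\<bar> ^ k)"
          using assms by (intro summable_mult summable_geometric) auto
      qed
    qed (auto intro!: continuous_intros)
    then obtain g where g: "uniform_limit (cball w 1) ?P g sequentially"
      unfolding uniformly_convergent_on_def by blast
    have "g z = q_exponential q z" if "z \<in> cball w 1" for z
      by (rule LIMSEQ_unique[OF tendsto_uniform_limitI[OF g that] q_exponential_LIMSEQ[OF assms]])
    then have "uniform_limit (cball w 1) ?P g sequentially \<longleftrightarrow> ?thesis"
      by (intro uniform_limit_cong') auto
    with g show ?thesis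
      by blast
  qed
  then have "\<exists>d>0. cball w d \<subseteq> UNIV \<and> uniform_limit (cball w d) ?P (q_exponential q) sequentially" for w
    by (intro exI[of _ 1]) simp
  moreover have "?P n holomorphic_on UNIV" for n
    by (auto intro!: holomorphic_intros)
  ultimately show "q_exponential q holomorphic_on UNIV"
    using holomorphic_uniform_sequence[OF open_UNIV, of ?P] by blast
qed simp

subsection \<open>Comparing entire functions\<close>

text \<open>Each zero of \<open>g\<close> in \<open>K\<close> is simple and also a zero of
  \<open>f\<close>, so \<open>f / g\<close> extends continuously over it, and a continuous function
  on a compact set is bounded.\<close>

lemma norm_le_mult_on_compact:
  fixes f g :: "complex \<Rightarrow> complex"
  assumes f: "f holomorphic_on UNIV" and g: "g holomorphic_on UNIV" and K: "compact K"
    and zero: "\<And>s. s \<in> K \<Longrightarrow> g s = 0 \<Longrightarrow> f s = 0 \<and> deriv g s \<noteq> 0"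
  obtains C where "\<And>s. s \<in> K \<Longrightarrow> norm (f s) \<le> C * norm (g s)"
proof -
  \<comment> \<open>At a zero of \<open>g\<close> this is the limit of the quotient, as seen below
    by dividing both functions by \<open>w - s\<close>.\<close>
  define R where "R s = (if g s = 0 then deriv f s / deriv g s else f s / g s)" for s
  have df: "(f has_field_derivative deriv f s) (at s)" for s
    using f holomorphic_derivI by blast
  have dg: "(g has_field_derivative deriv g s) (at s)" for s
    using g holomorphic_derivI by blast
  have "isCont R s" if "s \<in> K" for s
  proof (cases "g s = 0")
    case True
    with zero that have fs: "f s = 0" and d: "deriv g s \<noteq> 0"
      by auto
    have lg: "((\<lambda>w. g w / (w - s)) \<longlongrightarrow> deriv g s) (at s)"
      using dg[of s] True by (simp add: has_field_derivative_iff)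
    have lf: "((\<lambda>w. f w / (w - s)) \<longlongrightarrow> deriv f s) (at s)"
      using df[of s] fs by (simp add: has_field_derivative_iff)
    have nz: "\<forall>\<^sub>F w in at s. g w / (w - s) \<noteq> 0"
      using lg d by (rule tendsto_imp_eventually_ne)
    have "((\<lambda>w. (f w / (w - s)) / (g w / (w - s))) \<longlongrightarrow> deriv f s / deriv g s) (at s)"
      using lf lg d by (intro tendsto_intros)
    moreover have "\<forall>\<^sub>F w in at s. (f w / (w - s)) / (g w / (w - s)) = R w"
      using nz by eventually_elim (auto simp: R_def)
    ultimately have "(R \<longlongrightarrow> deriv f s / deriv g s) (at s)"
      by (rule Lim_transform_eventually)
    then show ?thesis
      using True by (simp add: isCont_def R_def)
  next
    case False
    have "isCont g s" "isCont f s"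
      using df dg DERIV_isCont by blast+
    then have "isCont (\<lambda>w. f w / g w) s"
      using False by (intro continuous_intros) auto
    moreover have "\<forall>\<^sub>F w in nhds s. g w \<noteq> 0"
      using \<open>isCont g s\<close> False
      by (intro tendsto_imp_eventually_ne[of g "g s"]) (auto simp: isCont_def tendsto_at_iff_tendsto_nhds)
    then have "\<forall>\<^sub>F w in nhds s. f w / g w = R w"
      by eventually_elim (simp add: R_def)
    ultimately show ?thesis
      by (simp cong: isCont_cong)
  qed
  then have "continuous_on K R"
    by (simp add: continuous_at_imp_continuous_on)
  then have "bounded (R ` K)"
    using K compact_continuous_image compact_imp_bounded by blast
  then obtain C where C: "\<And>s. s \<in> K \<Longrightarrow> norm (R s) \<le> C"
    by (auto simp: bounded_iff)
  have "norm (f s) \<le> C * norm (g s)" if "s \<in> K" for s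
  proof (cases "g s = 0")
    case True
    then show ?thesis
      using zero[OF that] by simp
  next
    case False
    then show ?thesis
      using C[OF that] by (simp add: R_def norm_divide divide_simps)
  qed
  then show thesis
    by (rule that)
qed

text \<open>The quotient is meromorphic and its boundedness excludes poles. All singularities are
  therefore removable, and Liouville's theorem applies to the extension.\<close>

lemma entire_norm_le_mult_imp_eq_mult:
  fixes f g :: "complex \<Rightarrow> complex"
  assumes f: "f holomorphic_on UNIV" and g: "g holomorphic_on UNIV"
    and le: "\<And>s. norm (f s) \<le> C * norm (g s)" and nz: "g w \<noteq> 0"
  shows "\<exists>c. \<forall>s. f s = c * g s"
proof -
  define R where "R = (\<lambda>s. f s / g s)"
  \<comment> \<open>At zeros of \<open>g\<close> the quotient \<open>R\<close> has the default value
    0, so the bound there amounts to \<open>C \<ge> 0\<close>.\<close>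
  have C: "C \<ge> 0"
    using le[of w] nz by (metis norm_ge_zero order_trans zero_le_mult_iff norm_le_zero_iff)
  have bound: "norm (R s) \<le> C" for s
    using le[of s] C by (cases "g s = 0") (auto simp: R_def norm_divide divide_simps)
  have ana: "f analytic_on A" "g analytic_on A" for A
    using f g by (auto intro: analytic_on_subset simp flip: analytic_on_open)
  have mero: "R meromorphic_on {s}" for s
    unfolding R_def by (intro meromorphic_on_divide analytic_on_imp_meromorphic_on ana)
  have lim: "\<exists>c. R \<midarrow>s\<rightarrow> c" for s
  proof -
    have "\<not> is_pole R s"
    proof
      assume "is_pole R s"
      then have "filterlim (\<lambda>z. norm (R z)) at_top (at s)"
        by (simp add: is_pole_def filterlim_at_infinity_conv_norm_at_top)
      then have "\<forall>\<^sub>F z in at s. norm (R z) > C"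
        by (simp add: filterlim_at_top_dense)
      then have "\<forall>\<^sub>F z in at s. False"
        by eventually_elim (use bound in \<open>simp add: not_less[symmetric]\<close>)
      then show False
        by simp
    qed
    then show ?thesis
      using meromorphic_on_not_essential[OF mero, of s] by (auto simp: not_essential_def)
  qed
  have "remove_sings R analytic_on {s}" for s
    using lim mero by (meson meromorphic_on_isolated_singularity remove_sings_analytic_at)
  then have hol: "remove_sings R holomorphic_on UNIV"
    by (meson analytic_imp_holomorphic analytic_on_analytic_at)
  have "norm (remove_sings R s) \<le> C" for s
  proof -
    obtain c where c: "R \<midarrow>s\<rightarrow> c"
      using lim by blast
    then have "norm c \<le> C"
      using bound by (intro tendsto_upperbound[OF tendsto_norm]) auto
    then show ?thesis
      using remove_sings_eqI[OF c] by simp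
  qed
  then have "bounded (range (remove_sings R))"
    by (auto simp: bounded_iff)
  then obtain c where c: "\<And>s. remove_sings R s = c"
    using Liouville_theorem[OF hol] by (auto simp: constant_on_def)
  have "f s = c * g s" for s
  proof (cases "g s = 0")
    case True
    then show ?thesis
      using le[of s] by simp
  next
    case False
    have "R analytic_on {s}"
      unfolding R_def using False by (intro analytic_on_divide ana) auto
    then show ?thesis
      using c[of s] False by (simp add: R_def divide_eq_eq)
  qed
  then show ?thesis
    by blast
qed

subsection \<open>The modular relation\<close>

text \<open>By the Jacobi triple product this is the theta series with terms
  \<open>q powr (k\<^sup>2 / 2) * exp (2 * pi * h * k * s)\<close>, summed over all integers
  \<open>k\<close>, divided by the infinite product of the \<open>1 - q ^ k\<close> with
  \<open>k \<ge> 1\<close>, where \<open>q = exp (- (2 * pi * h))\<close>.\<close>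

definition theta_prod :: "real \<Rightarrow> complex \<Rightarrow> complex" where
  "theta_prod h s =
     q_exponential (exp (- (2 * pi * h))) (exp (of_real (2 * pi * h) * (s - 1 / 2)))
   * q_exponential (exp (- (2 * pi * h))) (exp (of_real (2 * pi * h) * (- s - 1 / 2)))"

lemma abs_nome_less_1: "h > 0 \<Longrightarrow> \<bar>exp (- (2 * pi * h))\<bar> < 1"
  by simp

lemma theta_prod_minus: "theta_prod h (- s) = theta_prod h s"
  by (simp add: theta_prod_def mult.commute)

lemma holomorphic_theta_prod:
  assumes "h > 0" "f holomorphic_on A"
  shows "(\<lambda>s. theta_prod h (f s)) holomorphic_on A"
proof -
  have E: "(\<lambda>s. q_exponential (exp (- (2 * pi * h))) (u s)) holomorphic_on A"
    if "u holomorphic_on A" for u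
    using holomorphic_on_compose[OF that holomorphic_q_exponential[OF abs_nome_less_1[OF assms(1)]]]
    by (simp add: o_def)
  show ?thesis
    unfolding theta_prod_def by (intro holomorphic_on_mult E holomorphic_intros assms)
qed

text \<open>The first product gains the factor \<open>1 + X\<close> and the second loses
  \<open>1 + Y\<close>. As \<open>X * Y = 1\<close>, we have \<open>1 + X = X * (1 + Y)\<close>, so
  only \<open>X\<close> is left over, without dividing by a factor that may vanish.\<close>

lemma theta_prod_plus_1:
  assumes "h > 0"
  shows "theta_prod h (s + 1) = exp (of_real (2 * pi * h) * (s + 1 / 2)) * theta_prod h s"
proof -
  define q where "q = exp (- (2 * pi * h))"
  define X where "X = exp (of_real (2 * pi * h) * (s + 1 / 2))"
  define Y where "Y = exp (of_real (2 * pi * h) * (- s - 1 / 2))"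
  have q: "\<bar>q\<bar> < 1"
    using abs_nome_less_1[OF assms] by (simp add: q_def)
  have XY: "X * Y = 1"
    by (simp add: X_def Y_def exp_add[symmetric] algebra_simps)
  have shift: "of_real q * exp (of_real (2 * pi * h) * w) = exp (of_real (2 * pi * h) * (w - 1))"
    for w :: complex
    unfolding q_def exp_of_real[symmetric] exp_add[symmetric] by (simp add: algebra_simps)
  have qX: "of_real q * X = exp (of_real (2 * pi * h) * (s - 1 / 2))"
    unfolding X_def shift by (simp add: algebra_simps)
  have qY: "of_real q * Y = exp (of_real (2 * pi * h) * (- (s + 1) - 1 / 2))"
    unfolding Y_def shift by (simp add: algebra_simps)
  have "theta_prod h (s + 1) = q_exponential q X * q_exponential q (of_real q * Y)"
    unfolding theta_prod_def q_def[symmetric] qY X_def by (simp add: algebra_simps)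
  also have "q_exponential q X = (1 + X) * q_exponential q (of_real q * X)"
    by (rule q_exponential_rec[OF q])
  also have "1 + X = X * (1 + Y)"
    using XY by (simp add: algebra_simps)
  also have "X * (1 + Y) * q_exponential q (of_real q * X) * q_exponential q (of_real q * Y)
      = X * (q_exponential q (of_real q * X) * ((1 + Y) * q_exponential q (of_real q * Y)))"
    by (simp add: mult_ac)
  also have "(1 + Y) * q_exponential q (of_real q * Y) = q_exponential q Y"
    by (rule q_exponential_rec[OF q, symmetric])
  also have "q_exponential q (of_real q * X) * q_exponential q Y = theta_prod h s"
    unfolding theta_prod_def q_def[symmetric] qX Y_def by simp
  finally show ?thesis
    by (simp add: X_def)
qed

lemma theta_prod_plus_imaginary_period:
  assumes "h \<noteq> 0"
  shows "theta_prod h (s + \<i> / of_real h) = theta_prod h s"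
proof -
  have 1: "of_real (2 * pi * h) * ((s + \<i> / of_real h) - 1 / 2)
      = of_real (2 * pi * h) * (s - 1 / 2) + 2 * of_real pi * \<i>"
    using assms by (simp add: field_simps)
  have 2: "of_real (2 * pi * h) * (- (s + \<i> / of_real h) - 1 / 2)
      = of_real (2 * pi * h) * (- s - 1 / 2) - 2 * of_real pi * \<i>"
    using assms by (simp add: field_simps)
  show ?thesis
    unfolding theta_prod_def 1 2 by (simp add: exp_add exp_diff exp_two_pi_i)
qed

section \<open>Location and simplicity of the zeros\<close>

lemma q_exponential_exp_eq_0D:
  assumes h: "h > 0" and eq: "q_exponential (exp (- (2 * pi * h))) (exp (of_real (2 * pi * h) * (s - 1 / 2))) = 0"
  obtains k :: nat and j :: int where "Re s = of_nat k + 1 / 2" "h * Im s = of_int j + 1 / 2"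
proof -
  from eq obtain k where "exp (of_real (2 * pi * h) * (s - 1 / 2)) * of_real (exp (- (2 * pi * h))) ^ k = - 1"
    using q_exponential_eq_0_iff[OF abs_nome_less_1[OF h]] by blast
  also have "of_real (exp (- (2 * pi * h))) ^ k = exp (of_real (2 * pi * h) * (- of_nat k) :: complex)"
    by (simp add: exp_of_real[symmetric] exp_of_nat_mult[symmetric] mult_ac)
  also have "exp (of_real (2 * pi * h) * (s - 1 / 2)) * \<dots> = exp (of_real (2 * pi * h) * (s - 1 / 2 - of_nat k))"
    by (simp add: exp_add[symmetric] algebra_simps)
  also have "- 1 = exp (of_real pi * \<i>)"
    by (simp add: exp_pi_i')
  finally obtain j :: int where
    "of_real (2 * pi * h) * (s - 1 / 2 - of_nat k)
      = of_real pi * \<i> + of_real (of_int (2 * j) * pi) * \<i>"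
    unfolding exp_eq by blast
  then have "2 * pi * h * (Re s - 1 / 2 - of_nat k) = 0" "2 * pi * h * Im s = pi + 2 * of_int j * pi"
    by (auto simp: complex_eq_iff)
  moreover from this(2) have "pi * (2 * (h * Im s)) = pi * (1 + 2 * of_int j)"
    by (simp add: algebra_simps)
  then have "2 * (h * Im s) = 1 + 2 * of_int j"
    using pi_neq_zero mult_left_cancel by blast
  ultimately show thesis
    using h that[of k j] by simp
qed

lemma theta_prod_eq_0D:
  assumes h: "h > 0" and eq: "theta_prod h s = 0"
  obtains k j :: int where "Re s = of_int k + 1 / 2" "h * Im s = of_int j + 1 / 2"
proof -
  consider "q_exponential (exp (- (2 * pi * h))) (exp (of_real (2 * pi * h) * (s - 1 / 2))) = 0"
    | "q_exponential (exp (- (2 * pi * h))) (exp (of_real (2 * pi * h) * (- s - 1 / 2))) = 0"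
    using eq by (auto simp: theta_prod_def)
  then show thesis
  proof cases
    case 1
    from q_exponential_exp_eq_0D[OF h this] show thesis
      by (metis of_int_of_nat_eq that)
  next
    case 2
    from q_exponential_exp_eq_0D[OF h this]
    obtain k :: nat and j :: int where "Re (- s) = of_nat k + 1 / 2" "h * Im (- s) = of_int j + 1 / 2"
      by blast
    then show thesis
      \<comment> \<open>The second product is the first one at \<open>- s\<close>, and
        \<open>- (k + 1 / 2) = (- k - 1) + 1 / 2\<close>.\<close>
      by (intro that[of "- int k - 1" "- j - 1"]) auto
  qed
qed

text \<open>On the line \<open>Re s = 1 / 2\<close> only the factor \<open>1 + X\<close> of index 0
  in the first product can vanish. At a zero its derivative is \<open>- 2 * pi * h\<close>, while
  the cofactor \<open>B\<close> is nonzero.\<close>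

lemma theta_prod_zero_simple:
  assumes h: "h > 0" and s: "Re s = 1 / 2" and eq: "theta_prod h s = 0"
  obtains D where "D \<noteq> 0" "(theta_prod h has_field_derivative D) (at s)"
proof -
  define q where "q = exp (- (2 * pi * h))"
  define X where "X w = exp (of_real (2 * pi * h) * (w - 1 / 2))" for w :: complex
  define B where "B w = q_exponential q (of_real q * X w)
     * q_exponential q (exp (of_real (2 * pi * h) * (- w - 1 / 2)))" for w :: complex
  have q: "\<bar>q\<bar> < 1" "0 < q" "q < 1"
    using h by (simp_all add: q_def)
  have fact: "theta_prod h = (\<lambda>w. (1 + X w) * B w)"
    unfolding theta_prod_def q_def[symmetric] X_def[symmetric] B_def
    by (subst q_exponential_rec[OF q(1)]) (simp add: mult_ac)
  have X: "norm (X s) = 1"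
    using s by (simp add: X_def)
  \<comment> \<open>Both arguments in \<open>B\<close> have norm \<open>q\<close> at
    \<open>s\<close>, and the products have no zeros inside the unit disc.\<close>
  have "norm (exp (of_real (2 * pi * h) * (- s - 1 / 2))) < 1"
    using s h by (simp add: mult_less_0_iff)
  then have B: "B s \<noteq> 0"
    using q X by (auto simp: B_def norm_mult q_exponential_nonzero)
  then have Xs: "X s = - 1"
    using eq by (simp add: fact eq_neg_iff_add_eq_0 add.commute)
  have "(X has_field_derivative X s * of_real (2 * pi * h)) (at s)"
    unfolding X_def by (auto intro!: derivative_eq_intros)
  then have dX: "((\<lambda>w. 1 + X w) has_field_derivative X s * of_real (2 * pi * h)) (at s)"
    by (auto intro!: derivative_eq_intros)
  have E: "(\<lambda>w. q_exponential q (v w)) holomorphic_on UNIV" if "v holomorphic_on UNIV" for v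
    using holomorphic_on_compose[OF that holomorphic_q_exponential[OF q(1)]] by (simp add: o_def)
  have "B holomorphic_on UNIV"
    unfolding B_def X_def by (intro holomorphic_on_mult E holomorphic_intros)
  then have "(B has_field_derivative deriv B s) (at s)"
    using holomorphic_derivI by blast
  from DERIV_mult[OF dX this]
  have "(theta_prod h has_field_derivative - of_real (2 * pi * h) * B s) (at s)"
    by (simp add: fact Xs)
  with B h show thesis
    by (intro that[of "- of_real (2 * pi * h) * B s"]) auto
qed

text \<open>Carries a property from a period rectangle to the whole plane. The equivalence in the
  assumption lets the induction run in both directions.\<close>

lemma periodic_int_multiple:
  fixes P :: "'a::ring_1 \<Rightarrow> bool"
  assumes "\<And>s. P (s + w) \<longleftrightarrow> P s"
  shows "P (s + of_int k * w) \<longleftrightarrow> P s"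
proof (induction k rule: int_induct[of _ 0])
  case (step1 i)
  then show ?case
    using assms[of "s + of_int i * w"] by (simp add: algebra_simps)
next
  case (step2 i)
  then show ?case
    using assms[of "s + of_int (i - 1) * w"] by (simp add: algebra_simps)
qed simp

text \<open>Translation by \<open>1\<close> or \<open>\<i> / h\<close> multiplies both sides by the same factor, and a period
  rectangle contains a single zero of the right-hand side, which is simple and also a zero of the
  left-hand side. Hence the quotient is bounded.\<close>

lemma theta_prod_modular_upto_const:
  assumes h: "h > 0"
  shows "\<exists>c. \<forall>s. theta_prod h s
    = c * (exp (of_real (pi * h) * s\<^sup>2) * theta_prod (1 / h) (\<i> * of_real h * s))"
proof -
  define g where "g s = exp (of_real (pi * h) * s\<^sup>2) * theta_prod (1 / h) (\<i> * of_real h * s)" for s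
  define K where "K = cbox 0 (Complex 1 (1 / h))"
  have h': "1 / h > 0"
    using h by simp
  have hol_f: "theta_prod h holomorphic_on UNIV"
    using holomorphic_theta_prod[OF h holomorphic_on_ident] .
  have hol_g: "g holomorphic_on UNIV"
    unfolding g_def by (auto intro!: holomorphic_on_mult holomorphic_theta_prod h' holomorphic_intros)
  have zero: "theta_prod h s = 0 \<and> deriv g s \<noteq> 0" if s: "s \<in> K" and gs: "g s = 0" for s
  proof
    have t0: "theta_prod (1 / h) (\<i> * of_real h * s) = 0"
      using gs by (simp add: g_def)
    from theta_prod_eq_0D[OF h' this] obtain k j :: int
      where kj: "- (h * Im s) = of_int k + 1 / 2" "Re s = of_int j + 1 / 2"
      using h by (auto simp: field_simps)
    \<comment> \<open>The closed rectangle contains only one candidate zero, its centre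
      \<open>1 / 2 + \<i> / (2 * h)\<close>.\<close>
    have "0 \<le> Re s" "Re s \<le> 1" "0 \<le> h * Im s" "h * Im s \<le> 1"
      using s h by (auto simp: K_def in_cbox_complex_iff field_simps)
    with kj have "j = 0" "k = - 1"
      by linarith+
    with kj have Re: "Re s = 1 / 2" and Im: "h * Im s = 1 / 2"
      by auto
    \<comment> \<open>At the centre the argument of the first product is
      \<open>exp (pi * \<i>) = - 1\<close>, so its factor of index 0 vanishes.\<close>
    have "of_real (2 * pi * h) * (s - 1 / 2) = of_real pi * \<i>"
      using Re Im by (simp add: complex_eq_iff)
    then have "q_exponential (exp (- (2 * pi * h))) (exp (of_real (2 * pi * h) * (s - 1 / 2))) = 0"
      using q_exponential_rec[OF abs_nome_less_1[OF h], of "- 1"] by (simp only: exp_pi_i') simp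
    then show "theta_prod h s = 0"
      by (simp add: theta_prod_def)
    \<comment> \<open>The point \<open>\<i> * h * s\<close> has real part \<open>- 1 / 2\<close>;
      evenness moves it to the line where zeros are known to be simple.\<close>
    have "theta_prod (1 / h) (- (\<i> * of_real h * s)) = 0"
      using t0 by (simp add: theta_prod_minus)
    then obtain D where D: "D \<noteq> 0"
      "(theta_prod (1 / h) has_field_derivative D) (at (- (\<i> * of_real h * s)))"
      using theta_prod_zero_simple[OF h', of "- (\<i> * of_real h * s)"] Im by auto
    have lin: "((\<lambda>w. - (\<i> * of_real h * w)) has_field_derivative - (\<i> * of_real h)) (at s)"
      by (auto intro!: derivative_eq_intros)
    have exp: "((\<lambda>w. exp (of_real (pi * h) * w\<^sup>2)) has_field_derivative
        exp (of_real (pi * h) * s\<^sup>2) * (of_real (pi * h) * (2 * s))) (at s)"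
      by (auto intro!: derivative_eq_intros)
    have "g = (\<lambda>w. exp (of_real (pi * h) * w\<^sup>2) * theta_prod (1 / h) (- (\<i> * of_real h * w)))"
      by (simp add: g_def theta_prod_minus fun_eq_iff)
    with DERIV_mult[OF exp DERIV_chain2[OF D(2) lin]]
    have "(g has_field_derivative D * - (\<i> * of_real h) * exp (of_real (pi * h) * s\<^sup>2)) (at s)"
      by (simp add: theta_prod_minus t0)
    then have "deriv g s = D * - (\<i> * of_real h) * exp (of_real (pi * h) * s\<^sup>2)"
      by (rule DERIV_imp_deriv)
    then show "deriv g s \<noteq> 0"
      using D h by simp
  qed
  have "compact K"
    by (simp add: K_def)
  obtain C where C: "\<And>s. s \<in> K \<Longrightarrow> norm (theta_prod h s) \<le> C * norm (g s)"
    by (rule norm_le_mult_on_compact[OF hol_f hol_g \<open>compact K\<close> zero]) auto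
  \<comment> \<open>Translation by 1 becomes an imaginary period of
    \<open>theta_prod (1 / h)\<close>, so the whole multiplier comes from the Gaussian.\<close>
  have g1: "g (s + 1) = exp (of_real (2 * pi * h) * (s + 1 / 2)) * g s" for s
  proof -
    have "\<i> * of_real h * (s + 1) = \<i> * of_real h * s + \<i> / of_real (1 / h)"
      using h by (simp add: field_simps)
    then have "theta_prod (1 / h) (\<i> * of_real h * (s + 1)) = theta_prod (1 / h) (\<i> * of_real h * s)"
      using theta_prod_plus_imaginary_period[of "1 / h"] h by simp
    moreover have "exp (of_real (pi * h) * (s + 1)\<^sup>2)
        = exp (of_real (2 * pi * h) * (s + 1 / 2)) * exp (of_real (pi * h) * s\<^sup>2)"
      by (simp add: exp_add[symmetric] power2_eq_square algebra_simps)
    ultimately show ?thesis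
      by (simp add: g_def)
  qed
  \<comment> \<open>Translation by \<open>\<i> / h\<close> shifts the reflected argument by 1; the
    resulting multiplier cancels the change of the Gaussian.\<close>
  have g2: "g (s + \<i> / of_real h) = g s" for s
  proof -
    have arg: "- (\<i> * of_real h * (s + \<i> / of_real h)) = - (\<i> * of_real h * s) + 1"
      using h by (simp add: field_simps)
    have "theta_prod (1 / h) (\<i> * of_real h * (s + \<i> / of_real h))
        = theta_prod (1 / h) (- (\<i> * of_real h * s) + 1)"
      by (simp only: arg[symmetric] theta_prod_minus)
    also have "\<dots> = exp (of_real (2 * pi * (1 / h)) * (- (\<i> * of_real h * s) + 1 / 2))
        * theta_prod (1 / h) (\<i> * of_real h * s)"
      by (simp only: theta_prod_plus_1[OF h'] theta_prod_minus)
    finally have "g (s + \<i> / of_real h)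
        = exp (of_real (pi * h) * (s + \<i> / of_real h)\<^sup>2 +
            of_real (2 * pi * (1 / h)) * (- (\<i> * of_real h * s) + 1 / 2))
        * theta_prod (1 / h) (\<i> * of_real h * s)"
      by (simp add: g_def exp_add)
    also have "of_real (pi * h) * (s + \<i> / of_real h)\<^sup>2 +
            of_real (2 * pi * (1 / h)) * (- (\<i> * of_real h * s) + 1 / 2) = of_real (pi * h) * s\<^sup>2"
      using h by (simp add: power2_eq_square field_simps)
    finally show ?thesis
      by (simp add: g_def)
  qed
  define P where "P s \<longleftrightarrow> norm (theta_prod h s) \<le> C * norm (g s)" for s
  have P1: "P (s + 1) \<longleftrightarrow> P s" for s
    unfolding P_def theta_prod_plus_1[OF h] g1 by (simp add: norm_mult)
  have P2: "P (s + \<i> / of_real h) \<longleftrightarrow> P s" for s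
    using h by (simp add: P_def theta_prod_plus_imaginary_period g2)
  have P: "P s" for s
  proof -
    define t where "t = s + of_int (- \<lfloor>Re s\<rfloor>) * 1 + of_int (- \<lfloor>h * Im s\<rfloor>) * (\<i> / of_real h)"
    have "Re t = frac (Re s)" "Im t = frac (h * Im s) / h"
      using h by (simp_all add: t_def frac_def field_simps)
    then have "t \<in> K"
      using h by (auto simp: K_def in_cbox_complex_iff divide_right_mono frac_lt_1[THEN less_imp_le])
    then have "P t"
      using C by (simp add: P_def)
    then show "P s"
      unfolding t_def periodic_int_multiple[of P, OF P2] periodic_int_multiple[of P, OF P1] .
  qed
  \<comment> \<open>This rules out that \<open>g\<close> is identically zero: zeros of
    \<open>theta_prod\<close> have real part an integer plus \<open>1 / 2\<close>.\<close>
  have "g 0 \<noteq> 0"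
  proof
    assume "g 0 = 0"
    then have "theta_prod (1 / h) 0 = 0"
      by (simp add: g_def)
    from theta_prod_eq_0D[OF h' this] obtain k :: int where "0 = real_of_int k + 1 / 2"
      by auto
    then have "real_of_int (2 * k) = real_of_int (- 1)"
      by simp
    then have "2 * k = - 1"
      by (simp only: of_int_eq_iff)
    then show False
      by presburger
  qed
  then have "\<exists>c. \<forall>s. theta_prod h s = c * g s"
    by (rule entire_norm_le_mult_imp_eq_mult[OF hol_f hol_g P[unfolded P_def]])
  then show ?thesis
    unfolding g_def .
qed

section \<open>Special values and the constant\<close>

lemma theta_prod_0:
  "theta_prod h 0 = (q_exponential ((exp (- (pi * h)))\<^sup>2) (of_real (exp (- (pi * h)))))\<^sup>2"
  by (simp add: theta_prod_def power2_eq_square exp_of_real[symmetric] exp_add[symmetric] mult.assoc)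

text \<open>The arguments are 1 and \<open>q\<close>, and the recurrence gives
  \<open>E\<^sub>q(1) = 2 * E\<^sub>q(q)\<close>. The base is written as a square to fit
  \<open>euler_q_exponential_triple\<close> with \<open>r = exp (- (pi * h))\<close>.\<close>

lemma theta_prod_half:
  assumes "h > 0"
  shows "theta_prod h (1 / 2) = 2 * (q_exponential ((exp (- (pi * h)))\<^sup>2) (of_real ((exp (- (pi * h)))\<^sup>2)))\<^sup>2"
proof -
  have q: "(exp (- (pi * h)))\<^sup>2 = exp (- (2 * pi * h))"
    by (simp add: power2_eq_square exp_add[symmetric])
  have "q_exponential (exp (- (2 * pi * h))) 1
      = 2 * q_exponential (exp (- (2 * pi * h))) (of_real (exp (- (2 * pi * h))))"
    using q_exponential_rec[OF abs_nome_less_1[OF assms], of 1] by simp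
  then show ?thesis
    unfolding q by (simp add: theta_prod_def power2_eq_square exp_of_real[symmetric])
qed

text \<open>The half-period multiplies the common argument at 0 by \<open>exp (pi * \<i>)\<close>
  and by \<open>exp (- (pi * \<i>))\<close>, both equal to \<open>- 1\<close>, so the two products
  coincide.\<close>

lemma theta_prod_half_imaginary:
  assumes "h > 0"
  shows "theta_prod h (\<i> / of_real (2 * h))
    = (q_exponential ((exp (- (pi * h)))\<^sup>2) (- of_real (exp (- (pi * h)))))\<^sup>2"
proof -
  have 1: "of_real (2 * pi * h) * (\<i> / of_real (2 * h) - 1 / 2) = of_real (- (pi * h)) + of_real pi * \<i>"
    using assms by (simp add: field_simps)
  have 2: "of_real (2 * pi * h) * (- (\<i> / of_real (2 * h)) - 1 / 2) = of_real (- (pi * h)) - of_real pi * \<i>"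
    using assms by (simp add: field_simps)
  have q: "(exp (- (pi * h)))\<^sup>2 = exp (- (2 * pi * h))"
    by (simp add: power2_eq_square exp_add[symmetric])
  show ?thesis
    unfolding theta_prod_def 1 2 q by (simp only: exp_add exp_diff exp_pi_i' exp_of_real) (simp add: power2_eq_square)
qed

text \<open>Multiplying the relations at the three special points determines \<open>c ^ 3\<close>.
  Moreover \<open>c\<close> is a nonnegative real, which singles out the cube root.\<close>

theorem theta_prod_modular:
  assumes h: "h > 0"
  shows "theta_prod h s = of_real (exp (pi / 12 * (1 / h - h)))
    * (exp (of_real (pi * h) * s\<^sup>2) * theta_prod (1 / h) (\<i> * of_real h * s))"
proof -
  obtain c where c: "\<And>s. theta_prod h s
      = c * (exp (of_real (pi * h) * s\<^sup>2) * theta_prod (1 / h) (\<i> * of_real h * s))"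
    using theta_prod_modular_upto_const[OF h] by blast
  define r where "r x = exp (- (pi * x))" for x :: real
  \<comment> \<open>These are the factors of Euler's identity for \<open>r x\<close>. Their squares
    are the values of \<open>theta_prod x\<close> at the special points, up to a factor 2 for
    \<open>D\<close>.\<close>
  define A where "A x = q_exponential ((r x)\<^sup>2) (of_real (r x))" for x
  define B where "B x = q_exponential ((r x)\<^sup>2) (- of_real (r x))" for x
  define D where "D x = q_exponential ((r x)\<^sup>2) (of_real ((r x)\<^sup>2))" for x
  have h': "1 / h > 0"
    using h by simp
  have r: "\<bar>r x\<bar> < 1" "\<bar>(r x)\<^sup>2\<bar> < 1" if "x > 0" for x
  proof -
    have "0 < r x" "r x < 1"
      using that by (simp_all add: r_def)
    then show "\<bar>r x\<bar> < 1" "\<bar>(r x)\<^sup>2\<bar> < 1"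
      by (auto simp: abs_square_less_1)
  qed
  have euler: "A x * B x * D x = 1" if "x > 0" for x
    using euler_q_exponential_triple[OF r(1)[OF that]] by (simp add: A_def B_def D_def)
  \<comment> \<open>\<open>A x\<close> is fixed by conjugation, hence real; this later makes
    \<open>c\<close> a quotient of nonnegative reals.\<close>
  have A2: "(A x)\<^sup>2 = of_real ((norm (A x))\<^sup>2)" if "x > 0" for x
  proof -
    have "cnj (A x) = A x"
      unfolding A_def by (subst cnj_q_exponential[OF r(2)[OF that]]) simp
    then show ?thesis
      using complex_norm_square[of "A x"] by (simp add: power2_eq_square)
  qed
  have eq1: "(A h)\<^sup>2 = c * (A (1 / h))\<^sup>2"
    using c[of 0] by (simp add: theta_prod_0 A_def r_def)
  \<comment> \<open>The map \<open>s \<mapsto> \<i> * h * s\<close> sends \<open>1 / 2\<close> to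
    the imaginary half-period for \<open>1 / h\<close>, and the imaginary half-period for
    \<open>h\<close> to \<open>- (1 / 2)\<close>. Hence \<open>D\<close> on one side meets
    \<open>B\<close> on the other.\<close>
  have "\<i> * of_real h * (1 / 2) = \<i> / of_real (2 * (1 / h))"
    using h by (simp add: field_simps)
  then have eq2: "2 * (D h)\<^sup>2 = c * (of_real (exp (pi * h / 4)) * (B (1 / h))\<^sup>2)"
    using c[of "1 / 2"] theta_prod_half_imaginary[OF h'] theta_prod_half[OF h]
    by (simp add: D_def B_def r_def power2_eq_square exp_of_real[symmetric])
  have half: "\<i> * of_real h * (\<i> / of_real (2 * h)) = - (1 / 2)"
    using h by (simp add: field_simps)
  have expo: "of_real (pi * h) * (\<i> / of_real (2 * h))\<^sup>2 = complex_of_real (- (pi / h / 4))"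
    using h by (simp add: field_simps power2_eq_square)
  have eq3: "(B h)\<^sup>2 = c * (of_real (exp (- (pi / h / 4))) * (2 * (D (1 / h))\<^sup>2))"
    using c[of "\<i> / of_real (2 * h)"] theta_prod_half_imaginary[OF h] theta_prod_half[OF h']
    unfolding half expo theta_prod_minus exp_of_real by (simp add: D_def B_def r_def)
  have "2 * (A h * B h * D h)\<^sup>2 = (A h)\<^sup>2 * (2 * (D h)\<^sup>2) * (B h)\<^sup>2"
    by (simp add: power_mult_distrib mult_ac)
  also have "\<dots> = 2 * c ^ 3 * of_real (exp (pi * h / 4) * exp (- (pi / h / 4)))
      * (A (1 / h) * B (1 / h) * D (1 / h))\<^sup>2"
    unfolding eq1 eq2 eq3 by (simp add: power_mult_distrib power3_eq_cube mult_ac)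
  finally have c3: "c ^ 3 * of_real (exp (pi * h / 4) * exp (- (pi / h / 4))) = 1"
    using euler h by simp
  define x where "x = (norm (A h))\<^sup>2 / (norm (A (1 / h)))\<^sup>2"
  have "A (1 / h) \<noteq> 0"
    using euler[OF h'] by auto
  then have cx: "c = of_real x"
    using eq1 A2[OF h] A2[OF h'] by (simp add: x_def field_simps)
  have "x ^ 3 * (exp (pi * h / 4) * exp (- (pi / h / 4))) = 1"
    using c3 unfolding cx by (simp only: of_real_power[symmetric] of_real_mult[symmetric] of_real_eq_1_iff)
  moreover have "exp (pi / 12 * (1 / h - h)) ^ 3 * (exp (pi * h / 4) * exp (- (pi / h / 4))) = 1"
  proof -
    have "3 * (pi / 12 * (1 / h - h)) + (pi * h / 4 + - (pi / h / 4)) = 0"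
      using h by (simp add: field_simps)
    then show ?thesis
      unfolding exp_of_nat_mult[symmetric] exp_add[symmetric] by simp
  qed
  ultimately have "x ^ 3 * (exp (pi * h / 4) * exp (- (pi / h / 4)))
      = exp (pi / 12 * (1 / h - h)) ^ 3 * (exp (pi * h / 4) * exp (- (pi / h / 4)))"
    by simp
  then have "x ^ 3 = exp (pi / 12 * (1 / h - h)) ^ 3"
    using mult_right_cancel[of "exp (pi * h / 4) * exp (- (pi / h / 4))"] exp_not_eq_zero no_zero_divisors
    by blast
  then have "x = exp (pi / 12 * (1 / h - h))"
    by (rule power_eq_imp_eq_base) (auto simp: x_def)
  then show ?thesis
    using c[of s] by (simp add: cx)
qed

subsection \<open>Asymptotics\<close>

text \<open>At a real point \<open>s\<close> the number \<open>\<i> * h * s\<close> is purely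
  imaginary, which makes the two arguments on the transformed side complex conjugates.\<close>

lemma q_exponential_modular_pos:
  fixes h s :: real
  assumes h: "h > 0"
  defines "x \<equiv> exp (Complex (- (pi / h)) (2 * pi * s))"
  shows "q_exponential (exp (- (2 * pi * h))) (of_real (exp (2 * pi * h * (s - 1 / 2))))
       * q_exponential (exp (- (2 * pi * h))) (of_real (exp (2 * pi * h * (- s - 1 / 2))))
    = of_real (exp (pi * h * s\<^sup>2 + pi / 12 * (1 / h - h)))
       * (q_exponential (exp (- (2 * pi / h))) x * q_exponential (exp (- (2 * pi / h))) (cnj x))"
proof -
  have 1: "complex_of_real (2 * pi * (1 / h)) * (\<i> * of_real h * of_real s - 1 / 2) = Complex (- (pi / h)) (2 * pi * s)"
    using h by (simp add: complex_eq_iff)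
  have 2: "complex_of_real (2 * pi * (1 / h)) * (- (\<i> * of_real h * of_real s) - 1 / 2) = cnj (Complex (- (pi / h)) (2 * pi * s))"
    using h by (simp add: complex_eq_iff)
  have "theta_prod (1 / h) (\<i> * of_real h * of_real s)
      = q_exponential (exp (- (2 * pi / h))) x * q_exponential (exp (- (2 * pi / h))) (cnj x)"
    unfolding theta_prod_def 1 2 by (simp add: x_def exp_cnj)
  moreover have "theta_prod h (of_real s)
      = q_exponential (exp (- (2 * pi * h))) (of_real (exp (2 * pi * h * (s - 1 / 2))))
       * q_exponential (exp (- (2 * pi * h))) (of_real (exp (2 * pi * h * (- s - 1 / 2))))"
    by (simp add: theta_prod_def exp_of_real[symmetric])
  ultimately show ?thesis
    using theta_prod_modular[OF h, of "of_real s"]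
    by (simp add: exp_of_real[symmetric] exp_add mult_ac)
qed

text \<open>This is the modular relation at \<open>s + \<i> / (2 * h)\<close>; the factor \<open>2 * cos (pi * s)\<close> comes from
  the factor \<open>k = 0\<close> of one of the two products.\<close>

lemma q_exponential_modular_neg:
  fixes h s :: real
  assumes h: "h > 0"
  defines "x \<equiv> exp (Complex (- (2 * pi / h)) (2 * pi * s))"
  shows "q_exponential (exp (- (2 * pi * h))) (- of_real (exp (2 * pi * h * (s - 1 / 2))))
       * q_exponential (exp (- (2 * pi * h))) (- of_real (exp (2 * pi * h * (- s - 1 / 2))))
    = of_real (2 * exp (pi * h * s\<^sup>2) * cos (pi * s) / exp (pi / 12 * (2 / h + h)))
       * (q_exponential (exp (- (2 * pi / h))) x * q_exponential (exp (- (2 * pi / h))) (cnj x))"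
proof -
  define r where "r = exp (- (2 * pi / h))"
  define w where "w = exp (Complex 0 (- (2 * pi * s)))"
  have r: "\<bar>r\<bar> < 1"
    using h by (simp add: r_def)
  have a1: "complex_of_real (2 * pi * h) * (of_real s + \<i> / of_real (2 * h) - 1 / 2)
      = of_real (2 * pi * h * (s - 1 / 2)) + of_real pi * \<i>"
    using h by (simp add: field_simps)
  have a2: "complex_of_real (2 * pi * h) * (- (of_real s + \<i> / of_real (2 * h)) - 1 / 2)
      = of_real (2 * pi * h * (- s - 1 / 2)) - of_real pi * \<i>"
    using h by (simp add: field_simps)
  have lhs: "theta_prod h (of_real s + \<i> / of_real (2 * h))
      = q_exponential (exp (- (2 * pi * h))) (- of_real (exp (2 * pi * h * (s - 1 / 2))))
       * q_exponential (exp (- (2 * pi * h))) (- of_real (exp (2 * pi * h * (- s - 1 / 2))))"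
    unfolding theta_prod_def a1 a2 by (simp only: exp_add exp_diff exp_pi_i' exp_of_real) simp
  have b1: "complex_of_real (2 * pi * (1 / h)) * (\<i> * of_real h * (of_real s + \<i> / of_real (2 * h)) - 1 / 2)
      = Complex (- (2 * pi / h)) (2 * pi * s)"
    using h by (simp add: complex_eq_iff field_simps)
  have b2: "complex_of_real (2 * pi * (1 / h)) * (- (\<i> * of_real h * (of_real s + \<i> / of_real (2 * h))) - 1 / 2)
      = Complex 0 (- (2 * pi * s))"
    using h by (simp add: complex_eq_iff field_simps)
  \<comment> \<open>As \<open>w\<close> has norm 1, its product need not be close to 1. Splitting
    off \<open>1 + w\<close> leaves the argument \<open>r * w\<close> of norm \<open>r\<close>,
    conjugate to \<open>x\<close>.\<close>
  have "of_real r * w = cnj x"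
  proof -
    have "complex_of_real (- (2 * pi / h)) + Complex 0 (- (2 * pi * s)) = cnj (Complex (- (2 * pi / h)) (2 * pi * s))"
      by (simp add: complex_eq_iff)
    then show ?thesis
      unfolding r_def w_def x_def exp_of_real[symmetric] exp_add[symmetric] exp_cnj by simp
  qed
  then have rhs: "theta_prod (1 / h) (\<i> * of_real h * (of_real s + \<i> / of_real (2 * h)))
      = q_exponential r x * ((1 + w) * q_exponential r (cnj x))"
    unfolding theta_prod_def b1 b2 using q_exponential_rec[OF r, of w] by (simp add: x_def w_def r_def)
  \<comment> \<open>The cross term supplies the phase \<open>exp (\<i> * pi * s)\<close> that turns
    \<open>1 + w\<close> into a cosine.\<close>
  have sq: "of_real (pi * h) * (of_real s + \<i> / of_real (2 * h))\<^sup>2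
      = complex_of_real (pi * h * s\<^sup>2) + of_real (- (pi / (4 * h))) + \<i> * of_real (pi * s)"
    using h by (simp add: power2_eq_square field_simps)
  have "exp (\<i> * of_real (pi * s)) * (1 + w) = exp (\<i> * of_real (pi * s)) + exp (- (\<i> * of_real (pi * s)))"
  proof -
    have "\<i> * of_real (pi * s) + Complex 0 (- (2 * pi * s)) = - (\<i> * of_real (pi * s))"
      by (simp add: complex_eq_iff)
    then show ?thesis
      unfolding w_def distrib_left exp_add[symmetric] by (simp only: mult_1_right)
  qed
  also have "\<dots> = of_real (2 * cos (pi * s))"
    using cos_exp_eq[of "of_real (pi * s)"] by (simp add: cos_of_real[symmetric] mult.commute)
  finally have cos: "exp (\<i> * of_real (pi * s)) * (1 + w) = of_real (2 * cos (pi * s))" .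
  \<comment> \<open>The coefficients of \<open>pi / h\<close> combine as
    \<open>1 / 12 - 1 / 4 = - 2 / 12\<close>.\<close>
  have c: "exp (pi / 12 * (1 / h - h)) * exp (- (pi / (4 * h))) = 1 / exp (pi / 12 * (2 / h + h))"
  proof -
    have "pi / 12 * (1 / h - h) + - (pi / (4 * h)) = - (pi / 12 * (2 / h + h))"
      using h by (simp add: field_simps)
    then show ?thesis
      unfolding exp_add[symmetric] by (simp only: exp_minus inverse_eq_divide)
  qed
  have "theta_prod h (of_real s + \<i> / of_real (2 * h))
      = of_real (exp (pi / 12 * (1 / h - h)) * exp (- (pi / (4 * h))) * exp (pi * h * s\<^sup>2))
        * (exp (\<i> * of_real (pi * s)) * (1 + w)) * (q_exponential r x * q_exponential r (cnj x))"
    unfolding theta_prod_modular[OF h, of "of_real s + \<i> / of_real (2 * h)"] rhs sq exp_add exp_of_real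
    by (simp add: mult_ac)
  also have "\<dots> = of_real (2 * exp (pi * h * s\<^sup>2) * cos (pi * s) / exp (pi / 12 * (2 / h + h)))
        * (q_exponential r x * q_exponential r (cnj x))"
    unfolding c cos by simp
  finally show ?thesis
    unfolding lhs r_def .
qed

text \<open>The left-hand product is \<open>X\<^sup>2\<close> because its arguments are conjugate,
  and the value at \<open>y\<close> is a real \<open>Y\<close>. Both \<open>X\<close> and
  \<open>Y\<close> lie within \<open>2 * \<delta>\<close> of 1, so
  \<open>\<bar>X\<^sup>2 - Y\<bar> \<le> 8 * \<delta>\<close>, and \<open>Y \<ge> 4 / 5\<close>
  bounds this by \<open>10 * \<delta> * Y\<close>.\<close>

lemma q_exponential_ratio:
  fixes q r y \<delta> :: real and x :: complex
  assumes q: "0 < q" "q < 1" and r: "0 < r" "r < 1"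
    and x: "norm x / (1 - r) \<le> \<delta>" and y: "\<bar>y\<bar> / (1 - q) \<le> \<delta>" and \<delta>: "\<delta> \<le> 1 / 10"
  shows "q_exponential q (of_real y) \<noteq> 0"
    and "\<exists>e. \<bar>e\<bar> \<le> 10 * \<delta> \<and>
      q_exponential r x * q_exponential r (cnj x) = of_real (1 + e) * q_exponential q (of_real y)"
proof -
  define X where "X = norm (q_exponential r x)"
  define Y where "Y = Re (q_exponential q (of_real y))"
  have "cnj (q_exponential q (of_real y)) = q_exponential q (of_real y)"
    using q by (subst cnj_q_exponential) auto
  then have Y: "q_exponential q (of_real y) = of_real Y"
    by (simp add: Y_def complex_eq_iff)
  have X: "q_exponential r x * q_exponential r (cnj x) = of_real (X\<^sup>2)"
    using r by (simp add: X_def cnj_q_exponential[symmetric] complex_norm_square[symmetric])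
  have nn: "0 \<le> norm x / (1 - r)"
    using r by simp
  have exp_le: "exp t - 1 \<le> 2 * \<delta>" if "0 \<le> t" "t \<le> \<delta>" for t
  proof -
    have "exp t \<le> 1 + t + t\<^sup>2"
      using that \<delta> by (intro exp_bound) auto
    also have "t\<^sup>2 \<le> t"
      using that \<delta> by (simp add: power2_eq_square mult_left_le)
    finally show ?thesis
      using that by simp
  qed
  have "norm (q_exponential r x - 1) \<le> 2 * \<delta>"
    using norm_q_exponential_minus_1_le[of r x] exp_le[OF nn x] r by linarith
  then have X1: "\<bar>X - 1\<bar> \<le> 2 * \<delta>"
    using norm_triangle_ineq3[of "q_exponential r x" 1] by (simp add: X_def)
  have "norm (q_exponential q (of_real y) - 1) \<le> 2 * \<delta>"
    using norm_q_exponential_minus_1_le[of q "of_real y"] exp_le[OF _ y] q by simp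
  then have Y1: "\<bar>Y - 1\<bar> \<le> 2 * \<delta>"
    unfolding Y by (metis norm_of_real of_real_1 of_real_diff)
  then have Y2: "Y \<ge> 4 / 5"
    using \<delta> by linarith
  then show "q_exponential q (of_real y) \<noteq> 0"
    unfolding Y by simp
  have "\<bar>X\<^sup>2 - 1\<bar> = \<bar>X - 1\<bar> * \<bar>X + 1\<bar>"
    by (simp add: abs_mult[symmetric] power2_eq_square algebra_simps)
  also have "\<dots> \<le> 2 * \<delta> * 3"
    using X1 \<delta> by (intro mult_mono) auto
  finally have "\<bar>X\<^sup>2 - Y\<bar> \<le> 8 * \<delta>"
    using Y1 by linarith
  also have "8 * \<delta> \<le> 10 * \<delta> * Y"
    using mult_left_mono[OF Y2, of "10 * \<delta>"] nn x by simp
  finally have "\<bar>X\<^sup>2 / Y - 1\<bar> \<le> 10 * \<delta>"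
    using Y2 by (simp add: field_simps abs_le_iff)
  then show "\<exists>e. \<bar>e\<bar> \<le> 10 * \<delta> \<and>
      q_exponential r x * q_exponential r (cnj x) = of_real (1 + e) * q_exponential q (of_real y)"
    unfolding X Y using Y2 by (intro exI[of _ "X\<^sup>2 / Y - 1"]) simp
qed

text \<open>The base \<open>exp (- 2 * pi * real n powr (- a))\<close> tends to 1, which costs a
  factor of order \<open>n powr a\<close> in the bound for its product. Since
  \<open>a < 1 / 2\<close>, eventually \<open>n powr (1 - a) \<ge> 2 * n powr a\<close>, and the
  decay of \<open>y n\<close> absorbs that factor. The values 1 and 2 of \<open>\<kappa>\<close>
  serve the two expansions.\<close>

lemma q_exponential_ratio_asymp:
  fixes a u \<kappa> :: real and x :: "nat \<Rightarrow> complex" and y :: "nat \<Rightarrow> real"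
  assumes a: "0 < a" "a < 1 / 2" and \<kappa>: "0 < \<kappa>" "\<kappa> \<le> 2"
    and x: "\<And>n. norm (x n) = exp (- \<kappa> * pi * real n powr a)"
    and y: "\<And>n. \<bar>y n\<bar> = exp (- 2 * pi * (u + real n powr (1 - a) + 1 / 2 * real n powr (- a)))"
  shows "\<exists>\<epsilon> :: nat \<Rightarrow> real. \<epsilon> \<in> O(\<lambda>n. exp (- \<kappa> * pi * real n powr a)) \<and>
    (\<forall>\<^sub>F n in sequentially.
       q_exponential (exp (- 2 * pi * real n powr (- a))) (of_real (y n)) \<noteq> 0 \<and>
       q_exponential (exp (- 2 * pi * real n powr a)) (x n)
         * q_exponential (exp (- 2 * pi * real n powr a)) (cnj (x n))
       = of_real (1 + \<epsilon> n) * q_exponential (exp (- 2 * pi * real n powr (- a))) (of_real (y n)))"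
proof -
  \<comment> \<open>The 2 bounds \<open>1 / (1 - r)\<close>, and \<open>exp (- 2 * pi * u)\<close>
    is the constant factor of \<open>\<bar>y n\<bar>\<close>.\<close>
  define \<delta> where "\<delta> n = (2 + exp (- 2 * pi * u)) * exp (- \<kappa> * pi * real n powr a)" for n
  let ?Q = "\<lambda>n. q_exponential (exp (- 2 * pi * real n powr (- a))) (of_real (y n))"
  let ?R = "\<lambda>n. q_exponential (exp (- 2 * pi * real n powr a)) (x n)
         * q_exponential (exp (- 2 * pi * real n powr a)) (cnj (x n))"
  have N: "filterlim (\<lambda>n. real n powr a) at_top sequentially"
    using a by real_asymp
  have "filterlim (\<lambda>n. real n powr (1 - 2 * a)) at_top sequentially"
    using a by real_asymp
  then have ev2: "\<forall>\<^sub>F n in sequentially. real n powr (1 - 2 * a) \<ge> 2"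
    by (simp add: filterlim_at_top)
  have ev1: "\<forall>\<^sub>F n in sequentially. real n powr a \<ge> 1"
    using N by (simp add: filterlim_at_top)
  have "\<delta> \<longlonglongrightarrow> (2 + exp (- 2 * pi * u)) * 0"
    unfolding \<delta>_def using a \<kappa>
    by (intro tendsto_mult tendsto_const) real_asymp
  then have ev\<delta>: "\<forall>\<^sub>F n in sequentially. \<delta> n < 1 / 10"
    by (rule order_tendstoD) simp
  define P where "P n e \<longleftrightarrow> \<bar>e\<bar> \<le> 10 * \<delta> n \<and> ?Q n \<noteq> 0 \<and> ?R n = of_real (1 + e) * ?Q n" for n e
  define \<epsilon> where "\<epsilon> n = (SOME e. P n e)" for n
  have "\<forall>\<^sub>F n in sequentially. \<exists>e. P n e"
    using ev1 ev2 ev\<delta> eventually_gt_at_top[of 0]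
  proof eventually_elim
    case (elim n)
    define N where "N = real n powr a"
    have N1: "N \<ge> 1"
      using elim by (simp add: N_def)
    have inv: "real n powr (- a) = 1 / N"
      by (simp add: N_def powr_minus_divide)
    define q r where "q = exp (- 2 * pi * real n powr (- a))" and "r = exp (- 2 * pi * real n powr a)"
    have q: "0 < q" "q < 1" and r: "0 < r" "r < 1"
      using N1 by (simp_all add: q_def r_def inv flip: N_def)
    have exp_pi: "1 + t \<le> exp (2 * pi * t)" if "t \<ge> 0" for t
    proof -
      have "t \<le> 2 * pi * t"
        using that pi_ge_two mult_right_mono[of 1 "2 * pi" t] by simp
      then show ?thesis
        using exp_ge_add_one_self[of "2 * pi * t"] by linarith
    qed
    have "2 \<le> exp (2 * pi * N)"
      using exp_pi[of N] N1 by simp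
    then have "r \<le> 1 / 2"
      by (simp add: r_def exp_minus field_simps flip: N_def)
    then have "norm (x n) / (1 - r) \<le> norm (x n) / (1 / 2)"
      using r by (intro divide_left_mono) auto
    also have "\<dots> \<le> \<delta> n"
      by (simp add: \<delta>_def x algebra_simps)
    finally have xle: "norm (x n) / (1 - r) \<le> \<delta> n" .
    \<comment> \<open>The aim is \<open>1 / (1 - q) \<le> 1 + N\<close>.\<close>
    have "1 + 1 / N \<le> exp (2 * pi * (1 / N))"
      using exp_pi[of "1 / N"] N1 by simp
    then have "q \<le> 1 / (1 + 1 / N)"
      using N1 by (simp add: q_def inv exp_minus field_simps)
    then have "1 / (1 + N) \<le> 1 - q"
      using N1 by (simp add: field_simps)
    then have "\<bar>y n\<bar> / (1 - q) \<le> \<bar>y n\<bar> / (1 / (1 + N))"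
      using N1 q by (intro divide_left_mono) auto
    also have "\<dots> = \<bar>y n\<bar> * (1 + N)"
      by simp
    \<comment> \<open>Half of the decay \<open>exp (- 4 * pi * N)\<close> pays for
      \<open>1 + N\<close>; the remaining half suffices because
      \<open>\<kappa> \<le> 2\<close>.\<close>
    also have "\<dots> \<le> (exp (- 2 * pi * u) * exp (- 2 * pi * (2 * N))) * exp (2 * pi * N)"
    proof (intro mult_mono)
      have "real n powr (1 - a) = real n powr (1 - 2 * a) * N"
        using elim by (simp add: N_def flip: powr_add)
      then have "real n powr (1 - a) \<ge> 2 * N"
        using elim N1 by (simp add: mult_right_mono)
      then have "u + 2 * N \<le> u + real n powr (1 - a) + 1 / 2 * real n powr (- a)"
        by (simp add: add_increasing2)
      then have "\<bar>y n\<bar> \<le> exp (- 2 * pi * (u + 2 * N))"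
        unfolding y exp_le_cancel_iff by (intro mult_left_mono_neg) auto
      then show "\<bar>y n\<bar> \<le> exp (- 2 * pi * u) * exp (- 2 * pi * (2 * N))"
        by (simp add: exp_add[symmetric] algebra_simps)
    qed (use exp_pi[of N] N1 in auto)
    also have "\<dots> = exp (- 2 * pi * u) * exp (- 2 * pi * N)"
      by (simp add: exp_add[symmetric])
    also have "\<dots> \<le> (2 + exp (- 2 * pi * u)) * exp (- \<kappa> * pi * N)"
      using \<kappa> N1 by (intro mult_mono) auto
    finally have yle: "\<bar>y n\<bar> / (1 - q) \<le> \<delta> n"
      by (simp add: \<delta>_def N_def)
    show ?case
      using q_exponential_ratio[OF q r xle yle less_imp_le[OF elim(3)]] unfolding P_def q_def r_def by blast
  qed
  then have "\<forall>\<^sub>F n in sequentially. P n (\<epsilon> n)"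
    unfolding \<epsilon>_def by eventually_elim (rule someI_ex)
  then have ev: "\<forall>\<^sub>F n in sequentially. \<bar>\<epsilon> n\<bar> \<le> 10 * \<delta> n \<and> ?Q n \<noteq> 0 \<and> ?R n = of_real (1 + \<epsilon> n) * ?Q n"
    unfolding P_def .
  have "\<epsilon> \<in> O(\<lambda>n. exp (- \<kappa> * pi * real n powr a))"
    by (rule bigoI[where c = "10 * (2 + exp (- 2 * pi * u))"], rule eventually_mono[OF ev]) (simp add: \<delta>_def algebra_simps)
  moreover have "\<forall>\<^sub>F n in sequentially. ?Q n \<noteq> 0 \<and> ?R n = of_real (1 + \<epsilon> n) * ?Q n"
    using ev by eventually_elim auto
  ultimately show ?thesis
    by blast
qed

theorem theorem2p1:
  fixes a u :: real and q :: "nat \<Rightarrow> real"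
  assumes a: "0 < a" "a < 1 / 2"
    and q: "\<And>n. q n = exp (- 2 * pi * real n powr (- a))"
  shows
    "(\<exists>\<epsilon> :: nat \<Rightarrow> real. \<epsilon> \<in> O(\<lambda>n. exp (- pi * real n powr a)) \<and>
       (\<forall>\<^sub>F n in sequentially.
          q_exponential (q n)
            (of_real (exp (2 * pi * (u + real n powr (1 - a) - 1 / 2 * real n powr (- a)))))
          = of_real (exp (pi * real n powr (- a) * (real n powr a * u + real n)\<^sup>2
                          + pi / 12 * (real n powr a - real n powr (- a)))
                     * (1 + \<epsilon> n))))
     \<and>
     (\<exists>\<epsilon> :: nat \<Rightarrow> real. \<epsilon> \<in> O(\<lambda>n. exp (- 2 * pi * real n powr a)) \<and>
       (\<forall>\<^sub>F n in sequentially.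
          q_exponential (q n)
            (- of_real (exp (2 * pi * (u + real n powr (1 - a) - 1 / 2 * real n powr (- a)))))
          = of_real (2 * exp (pi * real n powr (- a) * (real n powr a * u + real n)\<^sup>2)
                       * cos (pi * real n powr a * u)
                     / ((- 1) ^ n * exp (pi / 12 * (2 * real n powr a + real n powr (- a))))
                     * (1 + \<epsilon> n))))"
proof -
  \<comment> \<open>Up to sign, the argument of the companion factor
    \<open>E\<^sub>q(\<plusminus> q powr (1/2 + s))\<close>, which is cancelled at the end.\<close>
  define y where "y n = exp (- 2 * pi * (u + real n powr (1 - a) + 1 / 2 * real n powr (- a)))" for n
  define s where "s n = real n powr a * u + real n" for n
  \<comment> \<open>\<open>\<kappa> = 1\<close> gives a transformed argument at \<open>s\<close>,
    and \<open>\<kappa> = 2\<close> one at \<open>s + \<i> / (2 * h)\<close>.\<close>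
  define x where "x \<kappa> n = exp (Complex (- (\<kappa> * pi * real n powr a)) (2 * pi * s n))" for \<kappa> n
  have norm_x: "norm (x \<kappa> n) = exp (- \<kappa> * pi * real n powr a)" for \<kappa> n
    by (simp add: x_def)
  \<comment> \<open>Everything follows from \<open>h * s n = u + n powr (1 - a)\<close>;
    \<open>n > 0\<close> excludes the default value of \<open>powr\<close> at base 0.\<close>
  have args: "h > 0" "real n powr a = 1 / h" "2 * pi * (u + real n powr (1 - a) - 1 / 2 * h) = 2 * pi * h * (s n - 1 / 2)"
     "- 2 * pi * (u + real n powr (1 - a) + 1 / 2 * h) = 2 * pi * h * (- s n - 1 / 2)"
    if "n > 0" "h = real n powr (- a)" for n h
  proof -
    show h: "h > 0" and inv: "real n powr a = 1 / h"
      using that by (simp_all add: powr_minus_divide)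
    have "h * s n = (h * real n powr a) * u + real n powr (- a) * real n powr 1"
      using that by (simp add: s_def algebra_simps)
    then have hs: "h * s n = u + real n powr (1 - a)"
      unfolding powr_add[symmetric] inv using h by simp
    show "2 * pi * (u + real n powr (1 - a) - 1 / 2 * h) = 2 * pi * h * (s n - 1 / 2)"
      "- 2 * pi * (u + real n powr (1 - a) + 1 / 2 * h) = 2 * pi * h * (- s n - 1 / 2)"
      unfolding hs[symmetric] by (simp_all add: algebra_simps)
  qed
  obtain \<epsilon>1 where \<epsilon>1: "\<epsilon>1 \<in> O(\<lambda>n. exp (- 1 * pi * real n powr a))"
    and ev1: "\<forall>\<^sub>F n in sequentially.
       q_exponential (exp (- 2 * pi * real n powr (- a))) (of_real (y n)) \<noteq> 0 \<and>
       q_exponential (exp (- 2 * pi * real n powr a)) (x 1 n)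
         * q_exponential (exp (- 2 * pi * real n powr a)) (cnj (x 1 n))
       = of_real (1 + \<epsilon>1 n) * q_exponential (exp (- 2 * pi * real n powr (- a))) (of_real (y n))"
    using q_exponential_ratio_asymp[OF a _ _ norm_x, of 1 y u] by (auto simp: y_def)
  obtain \<epsilon>2 where \<epsilon>2: "\<epsilon>2 \<in> O(\<lambda>n. exp (- 2 * pi * real n powr a))"
    and ev2: "\<forall>\<^sub>F n in sequentially.
       q_exponential (exp (- 2 * pi * real n powr (- a))) (of_real (- y n)) \<noteq> 0 \<and>
       q_exponential (exp (- 2 * pi * real n powr a)) (x 2 n)
         * q_exponential (exp (- 2 * pi * real n powr a)) (cnj (x 2 n))
       = of_real (1 + \<epsilon>2 n) * q_exponential (exp (- 2 * pi * real n powr (- a))) (of_real (- y n))"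
    using q_exponential_ratio_asymp[OF a _ _ norm_x, of 2 "\<lambda>n. - y n" u] by (auto simp: y_def)
  have "\<forall>\<^sub>F n in sequentially.
          q_exponential (q n)
            (of_real (exp (2 * pi * (u + real n powr (1 - a) - 1 / 2 * real n powr (- a)))))
          = of_real (exp (pi * real n powr (- a) * (real n powr a * u + real n)\<^sup>2
                          + pi / 12 * (real n powr a - real n powr (- a)))
                     * (1 + \<epsilon>1 n))"
    using ev1 eventually_gt_at_top[of 0]
  proof eventually_elim
    case (elim n)
    define h where "h = real n powr (- a)"
    note A = args[OF elim(2) h_def]
    have Q: "q n = exp (- (2 * pi * h))"
      by (simp add: q h_def)
    have yn: "y n = exp (2 * pi * h * (- s n - 1 / 2))"
      using A(4) by (simp only: y_def h_def)
    have "q_exponential (q n) (of_real (exp (2 * pi * (u + real n powr (1 - a) - 1 / 2 * h))))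
        * q_exponential (q n) (of_real (y n))
      = of_real (exp (pi * h * (s n)\<^sup>2 + pi / 12 * (1 / h - h)))
       * (q_exponential (exp (- (2 * pi / h))) (x 1 n) * q_exponential (exp (- (2 * pi / h))) (cnj (x 1 n)))"
      using q_exponential_modular_pos[OF A(1), of "s n"]
      unfolding yn A(3) Q by (simp add: x_def A(2))
    \<comment> \<open>The transformed products are traded for the companion factor, which is nonzero
      and then cancels.\<close>
    also have "q_exponential (exp (- (2 * pi / h))) (x 1 n) * q_exponential (exp (- (2 * pi / h))) (cnj (x 1 n))
        = of_real (1 + \<epsilon>1 n) * q_exponential (q n) (of_real (y n))"
      using elim(1) by (simp add: A(2) q)
    finally have "q_exponential (q n) (of_real (exp (2 * pi * (u + real n powr (1 - a) - 1 / 2 * h)))) * q_exponential (q n) (of_real (y n))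
      = of_real (exp (pi * h * (s n)\<^sup>2 + pi / 12 * (1 / h - h)) * (1 + \<epsilon>1 n)) * q_exponential (q n) (of_real (y n))"
      by (simp only: of_real_mult mult.assoc)
    moreover have "q_exponential (q n) (of_real (y n)) \<noteq> 0"
      using elim(1) by (simp add: q)
    ultimately have "q_exponential (q n) (of_real (exp (2 * pi * (u + real n powr (1 - a) - 1 / 2 * h))))
      = of_real (exp (pi * h * (s n)\<^sup>2 + pi / 12 * (1 / h - h)) * (1 + \<epsilon>1 n))"
      by simp
    then show ?case
      by (simp add: h_def[symmetric] s_def A(2))
  qed
  moreover have "\<forall>\<^sub>F n in sequentially.
          q_exponential (q n)
            (- of_real (exp (2 * pi * (u + real n powr (1 - a) - 1 / 2 * real n powr (- a)))))
          = of_real (2 * exp (pi * real n powr (- a) * (real n powr a * u + real n)\<^sup>2)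
                       * cos (pi * real n powr a * u)
                     / ((- 1) ^ n * exp (pi / 12 * (2 * real n powr a + real n powr (- a))))
                     * (1 + \<epsilon>2 n))"
    using ev2 eventually_gt_at_top[of 0]
  proof eventually_elim
    case (elim n)
    define h where "h = real n powr (- a)"
    note A = args[OF elim(2) h_def]
    have Q: "q n = exp (- (2 * pi * h))"
      by (simp add: q h_def)
    have yn: "y n = exp (2 * pi * h * (- s n - 1 / 2))"
      using A(4) by (simp only: y_def h_def)
    have "q_exponential (q n) (- of_real (exp (2 * pi * (u + real n powr (1 - a) - 1 / 2 * h))))
        * q_exponential (q n) (of_real (- y n))
      = of_real (2 * exp (pi * h * (s n)\<^sup>2) * cos (pi * s n) / exp (pi / 12 * (2 / h + h)))
       * (q_exponential (exp (- (2 * pi / h))) (x 2 n) * q_exponential (exp (- (2 * pi / h))) (cnj (x 2 n)))"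
      using q_exponential_modular_neg[OF A(1), of "s n"]
      unfolding yn A(3) Q by (simp add: x_def A(2))
    also have "q_exponential (exp (- (2 * pi / h))) (x 2 n) * q_exponential (exp (- (2 * pi / h))) (cnj (x 2 n))
        = of_real (1 + \<epsilon>2 n) * q_exponential (q n) (of_real (- y n))"
      using elim(1) by (simp add: A(2) q)
    finally have "q_exponential (q n) (- of_real (exp (2 * pi * (u + real n powr (1 - a) - 1 / 2 * h)))) * q_exponential (q n) (of_real (- y n))
      = of_real (2 * exp (pi * h * (s n)\<^sup>2) * cos (pi * s n) / exp (pi / 12 * (2 / h + h)) * (1 + \<epsilon>2 n)) * q_exponential (q n) (of_real (- y n))"
      by (simp only: of_real_mult mult.assoc)
    moreover have "q_exponential (q n) (of_real (- y n)) \<noteq> 0"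
      using elim(1) by (simp add: q)
    ultimately have eq: "q_exponential (q n) (- of_real (exp (2 * pi * (u + real n powr (1 - a) - 1 / 2 * h))))
      = of_real (2 * exp (pi * h * (s n)\<^sup>2) * cos (pi * s n) / exp (pi / 12 * (2 / h + h)) * (1 + \<epsilon>2 n))"
      by (rule mult_right_cancel[THEN iffD1, rotated])
    \<comment> \<open>The shift by \<open>n * pi\<close> contributes \<open>(- 1) ^ n\<close>, a
      sign equal to its inverse, so it may stand in the denominator.\<close>
    have "cos (pi * s n) = cos (pi * real n powr a * u) * (- 1) ^ n"
      by (simp add: s_def distrib_left cos_add cos_npi2 sin_npi2 mult.assoc)
    also have "\<dots> = cos (pi * real n powr a * u) / (- 1) ^ n"
      by (cases "even n") auto
    finally show ?case
      using eq by (simp add: h_def[symmetric] s_def A(2))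
  qed
  moreover have "\<epsilon>1 \<in> O(\<lambda>n. exp (- pi * real n powr a))"
    using \<epsilon>1 by simp
  ultimately show ?thesis
    using \<epsilon>2 by blast
qed

end
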